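(* Each of the first-order parts ${}^1\mathsf{COH}$, ${}^1\mathsf{FIP}$, and ${}^1\Pi^0_1\mathsf{G}$ is uniformly computably true.
   Context: A problem is a partial multifunction $\mathsf{P} :\subseteq \omega^\omega \rightrightarrows \omega^\omega$. Each $f \in \mathrm{dom}(\mathsf{P})$ (so $\mathsf{P}(f) \neq \emptyset$) is a $\mathsf{P}$-instance, and each $g \in \mathsf{P}(f)$ is a $\mathsf{P}$-solution to $f$. "Set" means subset of $\omega$; sets are identified with their characteristic functions, and families $\langle A_i : i \in \omega\rangle$ of sets are coded as single elements of $2^\omega$ by standard pairing. The set $\omega$ is embedded in $\omega^\omega$ by identifying $x \in \omega$ with the $f \in \omega^\omega$ such that $f(0)=x$ and $f(y)=0$ for all $y>0$. Angle brackets around functions denote Turing joins. Turing functionals are regarded as partial maps $\omega^\omega \to \omega^\omega$, $\Psi(f,g)$ means $\Psi(\langle f,g\rangle)$, and $\Psi(f)(x)$ is the value at $x$ of the computation with oracle $f$. When a Turing functional is part of an instance, it is given by an index in a fixed computable listing of all Turing functionals. The first-order part ${}^1\mathsf{P}$ of a problem $\mathsf{P}$ is the following problem. Its instances are all triples $\langle f,\Phi,\Psi\rangle$, where $f \in \omega^\omega$ and $\Phi,\Psi$ are Turing functionals such that $\Phi(f) \in \mathrm{dom}(\mathsf{P})$ and $\Psi(f,g)(0)\downarrow$ for all $g \in \mathsf{P}(\Phi(f))$. The solutions to such an instance are all $y \in \omega$ such that $\Psi(f,g)(0)\downarrow = y$ for some $g \in \mathsf{P}(\Phi(f))$. A problem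 $\mathsf{P}$ is uniformly computably true if there is a Turing functional $\Gamma$ such that $\Gamma(f) \in \mathsf{P}(f)$ for every $f \in \mathrm{dom}(\mathsf{P})$. A set $X$ is cohesive for a family $\langle A_i : i \in \omega\rangle$ if for all $i$, either $X \cap A_i$ or $X \cap \overline{A_i}$ is finite. A family $\langle B_i : i\in\omega\rangle$ is a subfamily of $\langle A_i : i \in \omega\rangle$, written $\langle B_i\rangle \subseteq \langle A_i\rangle$, if $(\forall i)(\exists j)[B_i = A_j]$. A family $\langle A_i : i \in \omega\rangle$ has the finite intersection property if $\bigcap_{i \in F} A_i \neq \emptyset$ for every nonempty finite set $F$. $\mathsf{COH}$: instances are all families of sets $\langle A_i : i \in \omega\rangle$; solutions are all infinite cohesive sets for the family. $\mathsf{FIP}$: instances are all families of sets $\langle A_i : i \in \omega\rangle$, not all empty; solutions are all the $\subseteq$-maximal subfamilies of $\langle A_i : i \in \omega\rangle$ that have the finite intersection property. $\Pi^0_1\mathsf{G}$: instances are all $f \in \omega^\omega$ together with (an index for) a $\Pi^{0,f}_1$-definable family $\langle U_i : i \in \omega\rangle$ of dense subsets of $2^{<\omega}$ (dense: every $\sigma \in 2^{<\omega}$ has an extension in $U_i$); solutions are all sets $G \subseteq \omega$ that meet every $U_i$, i.e., $(\forall i)(\exists k)[G \upharpoonright k \in U_i]$. *)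

theory Defs
  imports
    "HOL-Library.Nat_Bijection"
    "HOL-Library.Sublist"
    "HOL-Library.Indicator_Function"
begin

section \<open>Turing functionals\<close>

text \<open>
  Programs for the unary partial recursive functions relative to an oracle. Functions of several
  arguments are handled through the pairing function \<^const>\<open>prod_encode\<close>; the identity is
  \<open>Tuple Fst Snd\<close>. The only access to the oracle is the instruction \<open>Query\<close>.
\<close>

datatype code =
    Zero
  | Succ
  | Fst
  | Snd
  | Query
  | Tuple code code
  | Comp code code
  | Prec code code
  | Mu code

text \<open>
  \<open>Prec a b\<close> is primitive recursion on the second component of the input, with base case \<open>a\<close> and
  step \<open>b\<close>. \<open>Mu a\<close> is unbounded search: it diverges if \<open>a\<close> diverges at some argument before
  the first zero. Divergence is \<^const>\<open>None\<close>.
\<close>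

primrec eval :: "(nat \<Rightarrow> nat) \<Rightarrow> code \<Rightarrow> nat \<Rightarrow> nat option" where
  "eval f Zero x = Some 0"
| "eval f Succ x = Some (Suc x)"
| "eval f Fst x = Some (fst (prod_decode x))"
| "eval f Snd x = Some (snd (prod_decode x))"
| "eval f Query x = Some (f x)"
| "eval f (Tuple a b) x =
     (case eval f a x of
        None \<Rightarrow> None
      | Some u \<Rightarrow> (case eval f b x of None \<Rightarrow> None | Some v \<Rightarrow> Some (prod_encode (u, v))))"
| "eval f (Comp a b) x = (case eval f b x of None \<Rightarrow> None | Some u \<Rightarrow> eval f a u)"
| "eval f (Prec a b) x =
     (case prod_decode x of
        (y, n) \<Rightarrow>
          rec_nat (eval f a y)
            (\<lambda>k r. case r of
                      None \<Rightarrow> None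
                    | Some v \<Rightarrow> eval f b (prod_encode (y, prod_encode (k, v)))) n)"
| "eval f (Mu a) x =
     (if \<exists>n. eval f a (prod_encode (x, n)) = Some 0
            \<and> (\<forall>m<n. \<exists>v. eval f a (prod_encode (x, m)) = Some (Suc v))
      then Some (LEAST n. eval f a (prod_encode (x, n)) = Some 0)
      else None)"

text \<open>
  A computable listing of all programs: 0 to 4 are the atomic ones, and larger numbers
  are classified by their residue modulo 4.
\<close>

function decode :: "nat \<Rightarrow> code" where
  "decode n =
     (if n = 0 then Zero
      else if n = 1 then Succ
      else if n = 2 then Fst
      else if n = 3 then Snd
      else if n = 4 then Query
      else
        let m = (n - 5) div 4; r = (n - 5) mod 4 in
        if r = 0 then Tuple (decode (fst (prod_decode m))) (decode (snd (prod_decode m)))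
        else if r = 1 then Comp (decode (fst (prod_decode m))) (decode (snd (prod_decode m)))
        else if r = 2 then Prec (decode (fst (prod_decode m))) (decode (snd (prod_decode m)))
        else Mu (decode m))"
  by pat_completeness auto

lemma fst_prod_decode_le: "fst (prod_decode m) \<le> m"
  by (metis le_prod_encode_1 prod.collapse prod_decode_inverse)

lemma snd_prod_decode_le: "snd (prod_decode m) \<le> m"
  by (metis le_prod_encode_2 prod.collapse prod_decode_inverse)

termination decode
proof -
  have lt: "k < n" if "k \<le> (n - 5) div 4" "n \<noteq> 0" for k n :: nat
    using that by (meson div_le_dividend diff_less le_trans le_less_trans zero_less_numeral not_gr_zero)
  show ?thesis
    by (relation "measure id")
      (simp_all only: wf_measure in_measure id_apply, simp_all only: lt fst_prod_decode_le snd_prod_decode_le order_refl not_False_eq_True)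
qed

declare decode.simps [simp del]

primrec encode :: "code \<Rightarrow> nat" where
  "encode Zero = 0"
| "encode Succ = 1"
| "encode Fst = 2"
| "encode Snd = 3"
| "encode Query = 4"
| "encode (Tuple a b) = 5 + 4 * prod_encode (encode a, encode b)"
| "encode (Comp a b) = 6 + 4 * prod_encode (encode a, encode b)"
| "encode (Prec a b) = 7 + 4 * prod_encode (encode a, encode b)"
| "encode (Mu a) = 8 + 4 * encode a"

lemma decode_add:
  "decode (5 + 4 * k) = Tuple (decode (fst (prod_decode k))) (decode (snd (prod_decode k)))"
  "decode (6 + 4 * k) = Comp (decode (fst (prod_decode k))) (decode (snd (prod_decode k)))"
  "decode (7 + 4 * k) = Prec (decode (fst (prod_decode k))) (decode (snd (prod_decode k)))"
  "decode (8 + 4 * k) = Mu (decode k)"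
proof -
  have diff: "5 + 4 * k - 5 = 4 * k" "6 + 4 * k - 5 = 4 * k + 1"
    "7 + 4 * k - 5 = 4 * k + 2" "8 + 4 * k - 5 = 4 * k + 3"
    by linarith+
  have "(4 * k) div 4 = k" "(4 * k) mod 4 = 0" "(4 * k + 1) div 4 = k" "(4 * k + 1) mod 4 = 1"
    "(4 * k + 2) div 4 = k" "(4 * k + 2) mod 4 = 2" "(4 * k + 3) div 4 = k" "(4 * k + 3) mod 4 = 3"
    by (simp_all add: mod_Suc)
  note eqs = diff this
  show "decode (5 + 4 * k) = Tuple (decode (fst (prod_decode k))) (decode (snd (prod_decode k)))"
    by (subst decode.simps, unfold eqs Let_def) simp
  show "decode (6 + 4 * k) = Comp (decode (fst (prod_decode k))) (decode (snd (prod_decode k)))"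
    by (subst decode.simps, unfold eqs Let_def) simp
  show "decode (7 + 4 * k) = Prec (decode (fst (prod_decode k))) (decode (snd (prod_decode k)))"
    by (subst decode.simps, unfold eqs Let_def) simp
  show "decode (8 + 4 * k) = Mu (decode k)"
    by (subst decode.simps, unfold eqs Let_def) simp
qed

lemma decode_atomic:
  "decode 0 = Zero" "decode 1 = Succ" "decode 2 = Fst" "decode 3 = Snd" "decode 4 = Query"
  by (subst decode.simps, simp)+

lemma decode_encode: "decode (encode c) = c"
  by (induction c)
    (simp_all only: encode.simps decode_atomic decode_add prod_encode_inverse fst_conv snd_conv)

text \<open>
  \<open>turing e f x\<close> is the value at \<open>x\<close> of the computation of the functional with index \<open>e\<close> and
  oracle \<open>f\<close>. As a partial map on Baire space, the functional is defined at \<open>f\<close> only if this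
  converges for every \<open>x\<close>.
\<close>

definition turing :: "nat \<Rightarrow> (nat \<Rightarrow> nat) \<Rightarrow> nat \<Rightarrow> nat option" where
  "turing e f = eval f (decode e)"

definition maps_to :: "nat \<Rightarrow> (nat \<Rightarrow> nat) \<Rightarrow> (nat \<Rightarrow> nat) \<Rightarrow> bool" where
  "maps_to e f h \<longleftrightarrow> (\<forall>x. turing e f x = Some (h x))"

section \<open>Coding\<close>

definition join :: "(nat \<Rightarrow> nat) \<Rightarrow> (nat \<Rightarrow> nat) \<Rightarrow> nat \<Rightarrow> nat" where
  "join f g n = (if even n then f (n div 2) else g (n div 2))"

definition embed :: "nat \<Rightarrow> nat \<Rightarrow> nat" where
  "embed x n = (if n = 0 then x else 0)"

definition char_fun :: "nat set \<Rightarrow> nat \<Rightarrow> nat" where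
  "char_fun X = indicator X"

definition family_code :: "(nat \<Rightarrow> nat set) \<Rightarrow> nat \<Rightarrow> nat" where
  "family_code A = char_fun {prod_encode (i, x) | i x. x \<in> A i}"

definition string_code :: "bool list \<Rightarrow> nat" where
  "string_code \<sigma> = list_encode (map of_bool \<sigma>)"

definition restrict_set :: "nat set \<Rightarrow> nat \<Rightarrow> bool list" where
  "restrict_set G k = map (\<lambda>n. n \<in> G) [0..<k]"

section \<open>Problems and first-order parts\<close>

text \<open>
  A partial multifunction is represented by its total set-valued extension, which is empty outside
  the domain.
\<close>

type_synonym problem = "(nat \<Rightarrow> nat) \<Rightarrow> (nat \<Rightarrow> nat) set"

definition instances :: "problem \<Rightarrow> (nat \<Rightarrow> nat) set" where
  "instances P = {f. P f \<noteq> {}}"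

text \<open>
  The functionals in the triple are given by their indices \<open>e\<close> and \<open>i\<close>. All of \<open>f\<close>, \<open>e\<close>, \<open>i\<close>
  and \<open>h\<close> are determined by \<open>p\<close>.
\<close>

definition first_order_part :: "problem \<Rightarrow> problem" where
  "first_order_part P p =
     {embed y | y f e i h.
        p = join f (join (embed e) (embed i))
        \<and> maps_to e f h \<and> h \<in> instances P
        \<and> (\<forall>g \<in> P h. turing i (join f g) 0 \<noteq> None)
        \<and> (\<exists>g \<in> P h. turing i (join f g) 0 = Some y)}"

definition uniformly_computably_true :: "problem \<Rightarrow> bool" where
  "uniformly_computably_true P \<longleftrightarrow>
     (\<exists>e. \<forall>f \<in> instances P. \<exists>g. maps_to e f g \<and> g \<in> P f)"

section \<open>The problems COH, FIP and \<open>\<Pi>\<^sup>0\<^sub>1G\<close>\<close>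

definition cohesive :: "nat set \<Rightarrow> (nat \<Rightarrow> nat set) \<Rightarrow> bool" where
  "cohesive X A \<longleftrightarrow> (\<forall>i. finite (X \<inter> A i) \<or> finite (X \<inter> - A i))"

definition COH :: problem where
  "COH p = {char_fun X | X A. p = family_code A \<and> infinite X \<and> cohesive X A}"

definition subfamily :: "(nat \<Rightarrow> nat set) \<Rightarrow> (nat \<Rightarrow> nat set) \<Rightarrow> bool" where
  "subfamily B A \<longleftrightarrow> (\<forall>i. \<exists>j. B i = A j)"

definition finite_intersection_property :: "(nat \<Rightarrow> nat set) \<Rightarrow> bool" where
  "finite_intersection_property A \<longleftrightarrow> (\<forall>F. finite F \<and> F \<noteq> {} \<longrightarrow> (\<Inter>i\<in>F. A i) \<noteq> {})"

text \<open>
  Maximality is with respect to the preorder \<^const>\<open>subfamily\<close>: families that list the same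
  members, in any order and with any repetitions, are not distinguished.
\<close>

definition maximal_fip_subfamily :: "(nat \<Rightarrow> nat set) \<Rightarrow> (nat \<Rightarrow> nat set) \<Rightarrow> bool" where
  "maximal_fip_subfamily B A \<longleftrightarrow>
     subfamily B A \<and> finite_intersection_property B
     \<and> (\<forall>C. subfamily C A \<and> finite_intersection_property C \<and> subfamily B C \<longrightarrow> subfamily C B)"

definition FIP :: problem where
  "FIP p =
     {family_code B | B A.
        p = family_code A \<and> (\<exists>i. A i \<noteq> {}) \<and> maximal_fip_subfamily B A}"

text \<open>
  A number \<open>e\<close> is a \<open>\<Pi>\<^sup>0\<^sub>1\<close> index relative to \<open>f\<close> for the complement of the \<open>f\<close>-c.e. set with
  index \<open>e\<close>, that is, of the domain of the \<open>e\<close>-th partial \<open>f\<close>-computable function.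
\<close>

definition Pi01_family :: "nat \<Rightarrow> (nat \<Rightarrow> nat) \<Rightarrow> nat \<Rightarrow> bool list set" where
  "Pi01_family e f i = {\<sigma>. turing e f (prod_encode (i, string_code \<sigma>)) = None}"

definition dense_strings :: "bool list set \<Rightarrow> bool" where
  "dense_strings U \<longleftrightarrow> (\<forall>\<sigma>. \<exists>\<tau> \<in> U. prefix \<sigma> \<tau>)"

definition Pi01G :: problem where
  "Pi01G p =
     {char_fun G | G f e.
        p = join f (embed e)
        \<and> (\<forall>i. dense_strings (Pi01_family e f i))
        \<and> (\<forall>i. \<exists>k. restrict_set G k \<in> Pi01_family e f i)}"

end

theory Submission
  imports Defs "HOL-Library.Countable_Set"
begin

text \<open>
  For each of the three problems there are finite approximations \<open>\<sigma>\<close> to solutions that can be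
  recognised computably: every approximation extends to a solution, and every solution is
  approximated to any length. If \<open>\<Psi>(f, \<sigma>)(0)\<close> converges to \<open>y\<close> for an approximation \<open>\<sigma>\<close>, then
  \<open>\<Psi>(f, g)(0) = y\<close> for any solution \<open>g\<close> extending \<open>\<sigma>\<close>, and by the use principle such a \<open>\<sigma>\<close>
  exists; so the first value found in a search is a solution of the first-order part.
  For \<open>COH\<close> and \<open>\<Pi>\<^sup>0\<^sub>1G\<close> every binary string is an approximation. For \<open>FIP\<close> one takes finitely
  many members of the family together with a common element, which can be extended to a
  maximal subfamily. To search for convergent computations, finite derivations
  of their values are coded by numbers, so that being a derivation is decidable.
\<close>

section \<open>Computable functionals\<close>

text \<open>Totality at every oracle is part of the notion, so closure properties need no
  convergence hypotheses; unbounded search is confined to \<open>decidable_Least\<close>.\<close>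

definition computable :: "((nat \<Rightarrow> nat) \<Rightarrow> nat \<Rightarrow> nat) \<Rightarrow> bool" where
  "computable F \<longleftrightarrow> (\<exists>c. \<forall>p x. eval p c x = Some (F p x))"

definition decidable :: "((nat \<Rightarrow> nat) \<Rightarrow> nat \<Rightarrow> bool) \<Rightarrow> bool" where
  "decidable P \<longleftrightarrow> computable (\<lambda>p x. of_bool (P p x))"

definition pair :: "nat \<Rightarrow> nat \<Rightarrow> nat" where
  "pair x y = prod_encode (x, y)"

definition pfst :: "nat \<Rightarrow> nat" where
  "pfst z = fst (prod_decode z)"

definition psnd :: "nat \<Rightarrow> nat" where
  "psnd z = snd (prod_decode z)"

lemma pfst_pair [simp]: "pfst (pair x y) = x"
  and psnd_pair [simp]: "psnd (pair x y) = y"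
  and pair_pfst_psnd [simp]: "pair (pfst z) (psnd z) = z"
  by (simp_all add: pair_def pfst_def psnd_def)

lemma pair_eq_iff [simp]: "pair x y = pair u v \<longleftrightarrow> x = u \<and> y = v"
  by (simp add: pair_def)

lemma prod_decode_eq: "prod_decode z = (pfst z, psnd z)"
  by (simp add: pfst_def psnd_def)

lemma pfst_le: "pfst z \<le> z"
  by (simp add: pfst_def fst_prod_decode_le)

named_theorems computable_intros

lemma computable_const [computable_intros]: "computable (\<lambda>p x. n)"
proof -
  have "\<exists>c. \<forall>p x. eval p c x = Some n"
  proof (induction n)
    case 0
    have "\<forall>p x. eval p Zero x = Some 0" by simp
    then show ?case by blast
  next
    case (Suc n)
    then obtain c where "\<forall>p x. eval p c x = Some n" by blast
    then have "\<forall>p x. eval p (Comp Succ c) x = Some (Suc n)" by simp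
    then show ?case by blast
  qed
  then show ?thesis by (simp add: computable_def)
qed

lemma computable_id [computable_intros]: "computable (\<lambda>p x. x)"
  unfolding computable_def by (rule exI[of _ "Tuple Fst Snd"]) simp

lemma computable_compose:
  assumes "computable F" "computable G"
  shows "computable (\<lambda>p x. F p (G p x))"
proof -
  obtain a b where "\<forall>p x. eval p a x = Some (F p x)" "\<forall>p x. eval p b x = Some (G p x)"
    using assms by (auto simp: computable_def)
  then have "\<forall>p x. eval p (Comp a b) x = Some (F p (G p x))" by simp
  then show ?thesis unfolding computable_def by blast
qed

lemma computable_atomic:
  "computable (\<lambda>p. Suc)" "computable (\<lambda>p. pfst)" "computable (\<lambda>p. psnd)" "computable (\<lambda>p. p)"
  unfolding computable_def pfst_def psnd_def
  by (rule exI[of _ Succ] exI[of _ Fst] exI[of _ Snd] exI[of _ Query], simp)+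

lemma computable_Suc [computable_intros]:
  "computable F \<Longrightarrow> computable (\<lambda>p x. Suc (F p x))"
  by (rule computable_compose[OF computable_atomic(1)])

lemma computable_pfst [computable_intros]:
  "computable F \<Longrightarrow> computable (\<lambda>p x. pfst (F p x))"
  by (rule computable_compose[OF computable_atomic(2)])

lemma computable_psnd [computable_intros]:
  "computable F \<Longrightarrow> computable (\<lambda>p x. psnd (F p x))"
  by (rule computable_compose[OF computable_atomic(3)])

lemma computable_query [computable_intros]:
  "computable F \<Longrightarrow> computable (\<lambda>p x. p (F p x))"
  by (rule computable_compose[OF computable_atomic(4)])

lemma computable_pair [computable_intros]:
  assumes "computable F" "computable G"
  shows "computable (\<lambda>p x. pair (F p x) (G p x))"
proof -
  obtain a b where "\<forall>p x. eval p a x = Some (F p x)" "\<forall>p x. eval p b x = Some (G p x)"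
    using assms by (auto simp: computable_def)
  then have "\<forall>p x. eval p (Tuple a b) x = Some (pair (F p x) (G p x))"
    by (simp add: pair_def)
  then show ?thesis unfolding computable_def by blast
qed

text \<open>The step function takes one number \<open>z\<close> that packs the outer argument, the
  counter and the previous value, in the order in which \<open>Prec\<close> passes them.\<close>

lemma computable_rec_nat:
  assumes "computable A" "computable N"
    and "computable (\<lambda>p z. B p (pfst z) (pfst (psnd z)) (psnd (psnd z)))"
  shows "computable (\<lambda>p x. rec_nat (A p x) (B p x) (N p x))"
proof -
  obtain a b n where a: "\<forall>p x. eval p a x = Some (A p x)"
    and n: "\<forall>p x. eval p n x = Some (N p x)"
    and b: "\<forall>p z. eval p b z = Some (B p (pfst z) (pfst (psnd z)) (psnd (psnd z)))"
    using assms by (auto simp: computable_def)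
  have "eval p (Prec a b) (prod_encode (x, k)) = Some (rec_nat (A p x) (B p x) k)" for p x k
    by (induction k) (simp_all add: a b prod_decode_eq flip: pair_def)
  then have "\<forall>p x. eval p (Comp (Prec a b) (Tuple (Tuple Fst Snd) n)) x
      = Some (rec_nat (A p x) (B p x) (N p x))"
    by (simp add: n del: eval.simps(8))
  then show ?thesis unfolding computable_def by blast
qed

lemma computable_add [computable_intros]:
  assumes "computable F" "computable G"
  shows "computable (\<lambda>p x. F p x + G p x)"
proof -
  have "rec_nat a (\<lambda>_. Suc) b = a + b" for a b by (induction b) simp_all
  moreover have "computable (\<lambda>p x. rec_nat (F p x) (\<lambda>_. Suc) (G p x))"
    by (intro computable_rec_nat computable_intros assms)
  ultimately show ?thesis by simp
qed

lemma computable_mult [computable_intros]: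
  assumes "computable F" "computable G"
  shows "computable (\<lambda>p x. F p x * G p x)"
proof -
  have "rec_nat 0 (\<lambda>_ r. a + r) b = a * b" for a b :: nat by (induction b) simp_all
  moreover have "computable (\<lambda>p x. rec_nat 0 (\<lambda>_ r. F p x + r) (G p x))"
    \<comment> \<open>Within the step function the outer argument is a projection of
      \<open>z\<close>, so \<open>F\<close> has to be composed with that projection.\<close>
    by (intro computable_rec_nat computable_intros computable_compose[OF assms(1)] assms(2))
  ultimately show ?thesis by simp
qed

lemma computable_diff [computable_intros]:
  assumes "computable F" "computable G"
  shows "computable (\<lambda>p x. F p x - G p x)"
proof -
  \<comment> \<open>Returning the counter and discarding the previous value gives the predecessor;
    iterating it gives truncated subtraction.\<close>
  have pred: "rec_nat 0 (\<lambda>k _. k) n = n - 1" for n :: nat by (cases n) simp_all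
  have "rec_nat a (\<lambda>_ r. rec_nat 0 (\<lambda>k _. k) r) b = a - b" for a b :: nat
    by (induction b) (simp_all add: pred)
  moreover have "computable (\<lambda>p x. rec_nat (F p x) (\<lambda>_ r. rec_nat 0 (\<lambda>k _. k) r) (G p x))"
    by (intro computable_rec_nat computable_intros assms)
  ultimately show ?thesis by simp
qed

section \<open>Decidable relations, bounded quantifiers and unbounded search\<close>

lemma decidable_less [computable_intros]:
  assumes "computable F" "computable G"
  shows "decidable (\<lambda>p x. F p x < G p x)"
proof -
  \<comment> \<open>The recursion is the sign function, and \<open>b - a\<close> is positive exactly
    if \<open>a < b\<close>.\<close>
  have "rec_nat 0 (\<lambda>_ _. 1) (b - a) = (of_bool (a < b) :: nat)" for a b :: nat
    by (cases "b - a") simp_all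
  moreover have "computable (\<lambda>p x. rec_nat 0 (\<lambda>_ _. 1) (G p x - F p x))"
    by (intro computable_rec_nat computable_intros assms)
  ultimately show ?thesis by (simp add: decidable_def)
qed

lemma decidable_not [computable_intros]:
  assumes "decidable P"
  shows "decidable (\<lambda>p x. \<not> P p x)"
proof -
  have "computable (\<lambda>p x. 1 - of_bool (P p x))"
    by (intro computable_intros assms[unfolded decidable_def])
  moreover have "1 - of_bool b = (of_bool (\<not> b) :: nat)" for b by (cases b) simp_all
  ultimately show ?thesis by (simp add: decidable_def)
qed

lemma decidable_conj [computable_intros]:
  assumes "decidable P" "decidable Q"
  shows "decidable (\<lambda>p x. P p x \<and> Q p x)"
proof -
  have "computable (\<lambda>p x. of_bool (P p x) * of_bool (Q p x))"
    by (intro computable_intros assms[unfolded decidable_def])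
  then show ?thesis by (simp add: decidable_def of_bool_conj)
qed

lemma decidable_disj [computable_intros]:
  assumes "decidable P" "decidable Q"
  shows "decidable (\<lambda>p x. P p x \<or> Q p x)"
proof -
  have "decidable (\<lambda>p x. \<not> (\<not> P p x \<and> \<not> Q p x))"
    by (intro computable_intros assms)
  then show ?thesis by simp
qed

lemma decidable_eq [computable_intros]:
  assumes "computable F" "computable G"
  shows "decidable (\<lambda>p x. F p x = G p x)"
proof -
  have "decidable (\<lambda>p x. \<not> F p x < G p x \<and> \<not> G p x < F p x)"
    by (intro computable_intros assms)
  moreover have "\<not> a < b \<and> \<not> b < a \<longleftrightarrow> a = b" for a b :: nat by auto
  ultimately show ?thesis by simp
qed

lemma decidable_bex [computable_intros]:
  assumes "computable N" "decidable (\<lambda>p z. P p (pfst z) (psnd z))"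
  shows "decidable (\<lambda>p x. \<exists>k<N p x. P p x k)"
proof -
  \<comment> \<open>The accumulator \<open>r\<close> is the truth value of the quantifier restricted
    to the counters already passed.\<close>
  have "rec_nat 0 (\<lambda>k r. of_bool (0 < r \<or> R k)) n = (of_bool (\<exists>k<n. R k) :: nat)"
    for n and R :: "nat \<Rightarrow> bool"
    by (induction n) (auto simp: less_Suc_eq)
  moreover have "computable (\<lambda>p z. of_bool (P p (pfst z) (pfst (psnd z))))"
    using computable_compose[OF assms(2)[unfolded decidable_def],
        of "\<lambda>p z. pair (pfst z) (pfst (psnd z))"]
    by (simp add: computable_intros)
  then have "computable (\<lambda>p x. rec_nat 0 (\<lambda>k r. of_bool (0 < r \<or> P p x k)) (N p x))"
    by (intro computable_rec_nat computable_intros assms(1)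
        decidable_disj[unfolded decidable_def] decidable_less[unfolded decidable_def])
  ultimately show ?thesis by (simp add: decidable_def)
qed

lemma decidable_ball [computable_intros]:
  assumes "computable N" "decidable (\<lambda>p z. P p (pfst z) (psnd z))"
  shows "decidable (\<lambda>p x. \<forall>k<N p x. P p x k)"
proof -
  have "decidable (\<lambda>p x. \<not> (\<exists>k<N p x. \<not> P p x k))"
    by (intro computable_intros assms)
  then show ?thesis by simp
qed

text \<open>\<open>Mu\<close> looks for a zero, so it is applied to the truth value of the negation.
  One program serves all oracles; where nothing satisfies \<open>R\<close> it may diverge, hence the
  premise.\<close>

lemma decidable_Least:
  assumes "decidable R"
  obtains c where "\<And>p x. \<exists>s. R p s \<Longrightarrow> eval p c x = Some (LEAST s. R p s)"
proof -
  have "computable (\<lambda>p z. of_bool (\<not> R p (psnd z)))"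
    using computable_compose[OF decidable_not[OF assms, unfolded decidable_def] computable_atomic(3)] .
  then obtain a where a: "\<forall>p z. eval p a z = Some (of_bool (\<not> R p (psnd z)))"
    unfolding computable_def by blast
  have "eval p (Mu a) x = Some (LEAST s. R p s)" if "\<exists>s. R p s" for p x
  proof -
    have zero: "eval p a (prod_encode (x, s)) = Some 0 \<longleftrightarrow> R p s" for s
      by (simp add: a flip: pair_def)
    have "R p (LEAST s. R p s)" using that by (rule LeastI_ex)
    moreover have "\<exists>v. eval p a (prod_encode (x, m)) = Some (Suc v)"
      if "m < (LEAST s. R p s)" for m
      using not_less_Least[OF that] by (simp add: a flip: pair_def)
    ultimately show ?thesis unfolding eval.simps zero by auto
  qed
  then show thesis by (rule that)
qed

section \<open>Finite sequences coded by numbers\<close>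

text \<open>A number is read as an iterated pair without end marker. Every number is thus a valid
  code, and lengths are always supplied separately.\<close>

definition ent :: "nat \<Rightarrow> nat \<Rightarrow> nat" where
  "ent z k = pfst (rec_nat z (\<lambda>_. psnd) k)"

definition entries :: "nat \<Rightarrow> nat \<Rightarrow> nat set" where
  "entries z n = ent z ` {..<n}"

lemma entries_eq: "entries z n = set (map (ent z) [0..<n])"
  by (simp add: entries_def atLeast_upt)

lemma ent_pair_0 [simp]: "ent (pair x z) 0 = x"
  and ent_pair_Suc [simp]: "ent (pair x z) (Suc k) = ent z k"
proof -
  have "rec_nat (pair x z) (\<lambda>_. psnd) (Suc k) = rec_nat z (\<lambda>_. psnd) k"
    by (induction k) simp_all
  then show "ent (pair x z) (Suc k) = ent z k" by (simp add: ent_def)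
qed (simp add: ent_def)

lemma ex_ent_list:
  obtains z where "map (ent z) [0..<length xs] = xs"
proof -
  have "\<exists>z. \<forall>k<length xs. ent z k = xs ! k"
  proof (induction xs)
    case (Cons x xs)
    then obtain z where "\<forall>k<length xs. ent z k = xs ! k" by blast
    then have "\<forall>k<length (x # xs). ent (pair x z) k = (x # xs) ! k"
      by (auto simp: less_Suc_eq_0_disj)
    then show ?case by blast
  qed simp
  then obtain z where "\<forall>k<length xs. ent z k = xs ! k" ..
  then have "map (ent z) [0..<length xs] = xs" by (auto intro: nth_equalityI)
  then show thesis by (rule that)
qed

lemma ex_ent: obtains z where "\<forall>k<n. ent z k = f k"
proof -
  obtain z where z: "map (ent z) [0..<length (map f [0..<n])] = map f [0..<n]"
    by (rule ex_ent_list)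
  then show thesis using that[of z] by simp
qed

lemma computable_ent [computable_intros]:
  assumes "computable F" "computable G"
  shows "computable (\<lambda>p x. ent (F p x) (G p x))"
  unfolding ent_def by (intro computable_rec_nat computable_intros assms)

lemma decidable_mem_entries [computable_intros]:
  assumes "computable F" "computable Z" "computable N"
  shows "decidable (\<lambda>p x. F p x \<in> entries (Z p x) (N p x))"
proof -
  have "decidable (\<lambda>p x. \<exists>k<N p x. F p x = ent (Z p x) k)"
    by (intro computable_intros assms(3) assms(1,2)[THEN computable_compose])
  then show ?thesis by (simp add: entries_def image_iff Bex_def)
qed

lemma decidable_bex_entries [computable_intros]:
  assumes "computable Z" "computable N"
    and "decidable (\<lambda>p z. P p (pfst z) (ent (Z p (pfst z)) (psnd z)))"
  shows "decidable (\<lambda>p x. \<exists>t\<in>entries (Z p x) (N p x). P p x t)"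
proof -
  have "decidable (\<lambda>p x. \<exists>k<N p x. P p x (ent (Z p x) k))"
    by (intro computable_intros assms)
  then show ?thesis by (simp add: entries_def Bex_def)
qed

section \<open>Derivations of computations\<close>

text \<open>
  \<open>claim c x y\<close> codes the assertion that the program with number \<open>c\<close> has value \<open>y\<close> at \<open>x\<close>. The
  constructor numbers in \<open>justified\<close> are those of \<^const>\<open>encode\<close>, and \<open>Q\<close> is the known part
  of the graph of the oracle.
\<close>

definition claim :: "nat \<Rightarrow> nat \<Rightarrow> nat \<Rightarrow> nat" where
  "claim c x y = pair c (pair x y)"

abbreviation (input) "claim_prog t \<equiv> pfst t"
abbreviation (input) "claim_arg t \<equiv> pfst (psnd t)"
abbreviation (input) "claim_val t \<equiv> psnd (psnd t)"

lemma claim_sel: "claim (claim_prog t) (claim_arg t) (claim_val t) = t"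
  by (simp add: claim_def)

inductive justified :: "(nat \<Rightarrow> nat \<Rightarrow> bool) \<Rightarrow> nat set \<Rightarrow> nat \<Rightarrow> nat \<Rightarrow> nat \<Rightarrow> bool"
  for Q S where
  zero: "justified Q S 0 x 0"
| succ: "justified Q S 1 x (Suc x)"
| pfst: "justified Q S 2 x (pfst x)"
| psnd: "justified Q S 3 x (psnd x)"
| query: "Q x y \<Longrightarrow> justified Q S 4 x y"
| tuple: "claim a x u \<in> S \<Longrightarrow> claim b x v \<in> S \<Longrightarrow> justified Q S (5 + 4 * pair a b) x (pair u v)"
| comp: "claim b x u \<in> S \<Longrightarrow> claim a u y \<in> S \<Longrightarrow> justified Q S (6 + 4 * pair a b) x y"
| prec_0: "claim a x y \<in> S \<Longrightarrow> justified Q S (7 + 4 * pair a b) (pair x 0) y"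
| prec_Suc: "claim (7 + 4 * pair a b) (pair x k) v \<in> S \<Longrightarrow> claim b (pair x (pair k v)) y \<in> S \<Longrightarrow>
    justified Q S (7 + 4 * pair a b) (pair x (Suc k)) y"
| mu: "claim a (pair x y) 0 \<in> S \<Longrightarrow> (\<And>k. k < y \<Longrightarrow> \<exists>v. claim a (pair x k) (Suc v) \<in> S) \<Longrightarrow>
    justified Q S (8 + 4 * a) x y"

text \<open>An entry may cite only earlier entries, which excludes circular support and allows
  induction on positions.\<close>

definition derivation :: "(nat \<Rightarrow> nat \<Rightarrow> bool) \<Rightarrow> nat list \<Rightarrow> bool" where
  "derivation Q ts \<longleftrightarrow>
     (\<forall>k<length ts. justified Q (set (take k ts))
        (claim_prog (ts ! k)) (claim_arg (ts ! k)) (claim_val (ts ! k)))"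

text \<open>\<open>S\<close> occurs only positively in the rules. The oracle relations are compared
  only at the pair being queried, which \<open>derivation_mono\<close> exploits.\<close>

lemma justified_mono:
  assumes "justified Q S c x y" "S \<subseteq> T" "c = 4 \<Longrightarrow> Q x y \<Longrightarrow> R x y"
  shows "justified R T c x y"
proof -
  note ST = subsetD[OF assms(2)]
  show ?thesis
    using assms(1)
  proof cases
    case zero
    then show ?thesis by (simp only: justified.zero)
  next
    case succ
    then show ?thesis by (simp only: justified.succ)
  next
    case pfst
    then show ?thesis by (simp only: justified.pfst)
  next
    case psnd
    then show ?thesis by (simp only: justified.psnd)
  next
    case query
    then show ?thesis using ST assms(3) by (simp only:) (rule justified.query; blast)
  next
    case tuple
    then show ?thesis using ST assms(3) by (simp only:) (rule justified.tuple; blast)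
  next
    case comp
    then show ?thesis using ST assms(3) by (simp only:) (rule justified.comp; blast)
  next
    case prec_0
    then show ?thesis using ST assms(3) by (simp only:) (rule justified.prec_0; blast)
  next
    case prec_Suc
    then show ?thesis using ST assms(3) by (simp only:) (rule justified.prec_Suc; blast)
  next
    case mu
    then show ?thesis using ST assms(3) by (simp only:) (rule justified.mu; blast)
  qed
qed

text \<open>Each rule mirrors one equation of \<open>eval\<close>. For \<open>mu\<close>, the
  positive values claimed below \<open>y\<close> certify both convergence there and that
  \<open>y\<close> is the least zero.\<close>

lemma justified_sound:
  assumes "justified Q S c x y"
    and Q: "\<And>x y. Q x y \<Longrightarrow> y = f x"
    and S: "\<And>c x y. claim c x y \<in> S \<Longrightarrow> eval f (decode c) x = Some y"
  shows "eval f (decode c) x = Some y"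
  using assms(1)
proof cases
  case (tuple a u b v)
  then show ?thesis by (simp add: decode_add S flip: pfst_def psnd_def pair_def)
next
  case (comp b u a)
  then show ?thesis by (simp add: decode_add S flip: pfst_def psnd_def pair_def)
next
  case (prec_0 a x b)
  then show ?thesis by (simp add: decode_add S prod_decode_eq)
next
  case (prec_Suc a b x k v)
  have "eval f (decode c) (pair x k) = Some v"
    "eval f (decode b) (pair x (pair k v)) = Some y"
    using prec_Suc by (auto intro: S)
  then show ?thesis
    using prec_Suc(1,2) by (simp add: decode_add prod_decode_eq flip: pair_def)
next
  case (mu a)
  have zero: "eval f (decode a) (pair x y) = Some 0" using mu by (auto intro: S)
  have below: "\<exists>v. eval f (decode a) (pair x k) = Some (Suc v)" if "k < y" for k
    using mu(3)[OF that] by (auto dest!: S)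
  have "(LEAST n. eval f (decode a) (pair x n) = Some 0) = y"
  proof (rule Least_equality)
    show "y \<le> k" if "eval f (decode a) (pair x k) = Some 0" for k
      using that below[of k] by (cases "k < y") auto
  qed (rule zero)
  then show ?thesis using zero below by (auto simp: mu(1) decode_add simp flip: pair_def)
qed (simp_all add: Q[symmetric] decode_atomic[unfolded One_nat_def] pfst_def psnd_def)

text \<open>Strong induction on positions. \<open>Q\<close> need only be contained in the graph of
  \<open>f\<close>, so a derivation from finite information is valid for every oracle that agrees
  with it.\<close>

lemma derivation_sound:
  assumes "derivation Q ts" and Q: "\<And>x y. Q x y \<Longrightarrow> y = f x" and "claim c x y \<in> set ts"
  shows "eval f (decode c) x = Some y"
proof -
  have "eval f (decode c) x = Some y" if "k < length ts" "ts ! k = claim c x y" for k c x y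
    using that
  proof (induction k arbitrary: c x y rule: less_induct)
    case (less k)
    have "justified Q (set (take k ts)) c x y"
      using assms(1) less.prems by (auto simp: derivation_def claim_def)
    then show ?case
    proof (rule justified_sound)
      show "eval f (decode c) x = Some y" if "claim c x y \<in> set (take k ts)" for c x y
        using that less by (auto simp: in_set_conv_nth)
    qed (rule Q)
  qed
  then show ?thesis using assms(3) by (metis in_set_conv_nth)
qed

section \<open>Derivations of convergent computations\<close>

lemma derivation_Nil: "derivation Q []"
  by (simp add: derivation_def)

lemma derivation_append:
  assumes "derivation Q ts" "derivation Q us"
  shows "derivation Q (ts @ us)"
  unfolding derivation_def
proof (intro allI impI)
  fix k assume k: "k < length (ts @ us)"
  show "justified Q (set (take k (ts @ us))) (claim_prog ((ts @ us) ! k))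
      (claim_arg ((ts @ us) ! k)) (claim_val ((ts @ us) ! k))"
  proof (cases "k < length ts")
    case True
    then show ?thesis using assms(1) by (simp add: derivation_def nth_append)
  next
    case False
    then have "justified Q (set (take (k - length ts) us)) (claim_prog (us ! (k - length ts)))
      (claim_arg (us ! (k - length ts))) (claim_val (us ! (k - length ts)))"
      using assms(2) k by (simp add: derivation_def)
    then show ?thesis using False by (auto simp: nth_append elim!: justified_mono)
  qed
qed

lemma derivation_snoc:
  assumes "derivation Q ts" "justified Q (set ts) c x y"
  shows "derivation Q (ts @ [claim c x y])"
  using assms by (auto simp: derivation_def less_Suc_eq nth_append claim_def)

text \<open>The use principle: a derivation depends only on the finitely many oracle values that its
  query claims mention.\<close>

lemma derivation_mono:
  assumes "derivation Q ts" "\<And>x y. claim 4 x y \<in> set ts \<Longrightarrow> Q x y \<Longrightarrow> R x y"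
  shows "derivation R ts"
  unfolding derivation_def
proof (intro allI impI)
  fix k assume "k < length ts"
  then show "justified R (set (take k ts)) (claim_prog (ts ! k)) (claim_arg (ts ! k)) (claim_val (ts ! k))"
    using assms(1) assms(2)[of "claim_arg (ts ! k)" "claim_val (ts ! k)"]
      claim_sel[of "ts ! k"] nth_mem[of k ts]
    by (auto simp: derivation_def elim!: justified_mono)
qed

definition derivable :: "(nat \<Rightarrow> nat \<Rightarrow> bool) \<Rightarrow> nat \<Rightarrow> bool" where
  "derivable Q t \<longleftrightarrow> (\<exists>ts. derivation Q ts \<and> t \<in> set ts)"

lemma ex_derivation:
  assumes "finite S" "\<forall>t\<in>S. derivable Q t"
  obtains ts where "derivation Q ts" "S \<subseteq> set ts"
proof -
  have "\<exists>ts. derivation Q ts \<and> S \<subseteq> set ts"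
    using assms
  proof (induction S)
    case empty
    then show ?case using derivation_Nil by blast
  next
    case (insert t S)
    obtain us where "derivation Q us" "t \<in> set us"
      using insert.prems by (auto simp: derivable_def)
    moreover obtain ts where "derivation Q ts" "S \<subseteq> set ts"
      using insert.IH insert.prems by blast
    ultimately have "derivation Q (ts @ us) \<and> insert t S \<subseteq> set (ts @ us)"
      by (auto intro: derivation_append)
    then show ?case by blast
  qed
  then show thesis using that by blast
qed

text \<open>Derivations of the finitely many premises are concatenated and the new claim is put at
  the end. Completeness is thereby reduced to naming a finite set of premises.\<close>

lemma derivable_justified:
  assumes "finite S" "\<And>t. t \<in> S \<Longrightarrow> derivable Q t" "justified Q S c x y"
  shows "derivable Q (claim c x y)"
proof -
  obtain ts where ts: "derivation Q ts" "S \<subseteq> set ts" using ex_derivation[OF assms(1)] assms(2) by blast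
  have "derivation Q (ts @ [claim c x y])"
    using ts assms(3) by (auto intro: derivation_snoc justified_mono)
  then show ?thesis unfolding derivable_def by fastforce
qed

text \<open>Indices in instances are arbitrary numbers, while \<open>derivable_eval\<close> yields
  claims about numbers of the form \<open>encode c\<close>; this identity connects the two.\<close>

lemma encode_decode: "encode (decode n) = n"
proof (induction n rule: less_induct)
  case (less n)
  have code: "prod_encode (encode (decode (fst (prod_decode m))), encode (decode (snd (prod_decode m)))) = m"
    "encode (decode m) = m" if "m < n" for m
    using that less fst_prod_decode_le[of m] snd_prod_decode_le[of m] by simp_all
  define m where "m = (n - 5) div 4"
  have "n = 0 \<or> n = 1 \<or> n = 2 \<or> n = 3 \<or> n = 4 \<or>
      n = 5 + 4 * m \<or> n = 6 + 4 * m \<or> n = 7 + 4 * m \<or> n = 8 + 4 * m"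
    unfolding m_def by presburger
  then consider "n = 0" | "n = 1" | "n = 2" | "n = 3" | "n = 4"
    | "n = 5 + 4 * m" | "n = 6 + 4 * m" | "n = 7 + 4 * m" | "n = 8 + 4 * m"
    by blast
  then show ?case
  proof cases
    case 6
    then have "m < n" by simp
    from code(1)[OF this] show ?thesis unfolding 6 by (simp only: decode_add encode.simps)
  next
    case 7
    then have "m < n" by simp
    from code(1)[OF this] show ?thesis unfolding 7 by (simp only: decode_add encode.simps)
  next
    case 8
    then have "m < n" by simp
    from code(1)[OF this] show ?thesis unfolding 8 by (simp only: decode_add encode.simps)
  next
    case 9
    then have "m < n" by simp
    from code(2)[OF this] show ?thesis unfolding 9 by (simp only: decode_add encode.simps)
  qed (simp_all only: decode_atomic encode.simps)
qed

lemma derivable_eval: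
  assumes "eval f c x = Some y"
  shows "derivable (\<lambda>u v. v = f u) (claim (encode c) x y)"
  using assms
proof (induction c arbitrary: x y)
  case (Tuple a b)
  then obtain u v where "eval f a x = Some u" "eval f b x = Some v" "y = pair u v"
    by (auto simp: pair_def split: option.splits)
  with Tuple.IH show ?case
    by (intro derivable_justified[of "{claim (encode a) x u, claim (encode b) x v}"])
      (auto intro: justified.tuple simp flip: pair_def)
next
  case (Comp a b)
  then obtain u where "eval f b x = Some u" "eval f a u = Some y"
    by (auto split: option.splits)
  with Comp.IH show ?case
    by (intro derivable_justified[of "{claim (encode b) x u, claim (encode a) u y}"])
      (auto intro: justified.comp simp flip: pair_def)
next
  case (Prec a b)
  \<comment> \<open>Unfolding a recursion step leads to the same program at a smaller counter, so an
    inner induction on the counter is needed.\<close>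
  have "derivable (\<lambda>u v. v = f u) (claim (encode (Prec a b)) (pair z n) y)"
    if "eval f (Prec a b) (pair z n) = Some y" for z n y
    using that
  proof (induction n arbitrary: y)
    case 0
    then have "derivable (\<lambda>u v. v = f u) (claim (encode a) z y)"
      by (intro Prec.IH) (simp add: pair_def)
    then show ?case
      by (intro derivable_justified[of "{claim (encode a) z y}"])
        (auto intro: justified.prec_0 simp flip: pair_def)
  next
    case (Suc n)
    then obtain v where "eval f (Prec a b) (pair z n) = Some v"
      "eval f b (pair z (pair n v)) = Some y"
      by (auto simp: pair_def split: option.splits)
    with Suc.IH Prec.IH show ?case
      by (intro derivable_justified[of
            "{claim (encode (Prec a b)) (pair z n) v, claim (encode b) (pair z (pair n v)) y}"])
        (auto intro: justified.prec_Suc simp flip: pair_def)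
  qed
  from this[of "pfst x" "psnd x"] Prec.prems show ?case by simp
next
  case (Mu a)
  define P where "P n \<longleftrightarrow> eval f a (pair x n) = Some 0" for n
  obtain n where n: "P n" "\<forall>m<n. \<exists>v. eval f a (pair x m) = Some (Suc v)"
    and y: "y = (LEAST n. P n)"
    using Mu.prems by (auto simp: P_def pair_def split: if_splits)
  have Py: "P y" and le: "y \<le> n" using n(1) unfolding y by (auto intro: LeastI Least_le)
  then obtain v where v: "\<And>m. m < y \<Longrightarrow> eval f a (pair x m) = Some (Suc (v m))"
    using n(2) by (metis less_le_trans)
  \<comment> \<open>The premises are the zero at \<open>y\<close> and the positive values at all
    smaller arguments, hence finitely many.\<close>
  let ?S = "insert (claim (encode a) (pair x y) 0)
    ((\<lambda>m. claim (encode a) (pair x m) (Suc (v m))) ` {..<y})"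
  show ?case
  proof (rule derivable_justified[of ?S])
    show "justified (\<lambda>u v. v = f u) ?S (encode (Mu a)) x y"
      unfolding encode.simps by (rule justified.mu) auto
    show "derivable (\<lambda>u v. v = f u) t" if "t \<in> ?S" for t
      using that Py v Mu.IH by (auto simp: P_def)
  qed simp
qed (auto intro!: derivable_justified[of "{}"] intro: justified.intros[unfolded One_nat_def]
    simp flip: pfst_def psnd_def)

lemma derivable_turing:
  "turing e f x = Some y \<Longrightarrow> derivable (\<lambda>u v. v = f u) (claim e x y)"
  using derivable_eval[of f "decode e" x y] by (simp add: turing_def encode_decode)

section \<open>Decidability of being a derivation\<close>

lemma computable_claim [computable_intros]:
  "computable F \<Longrightarrow> computable G \<Longrightarrow> computable H \<Longrightarrow>
    computable (\<lambda>p x. claim (F p x) (G p x) (H p x))"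
  unfolding claim_def by (intro computable_intros)

text \<open>
  The intermediate values needed for composition, recursion and search are taken from claims
  in \<open>S\<close>, so that for finite \<open>S\<close> all quantifiers are bounded.
\<close>

lemma justified_iff:
  "justified Q S c x y \<longleftrightarrow>
     c = 0 \<and> y = 0 \<or> c = 1 \<and> y = Suc x \<or> c = 2 \<and> y = pfst x \<or> c = 3 \<and> y = psnd x \<or>
     c = 4 \<and> Q x y \<or>
     (\<exists>m<c. c = 5 + 4 * m \<and> claim (pfst m) x (pfst y) \<in> S \<and> claim (psnd m) x (psnd y) \<in> S) \<or>
     (\<exists>m<c. c = 6 + 4 * m \<and>
        (\<exists>t\<in>S. claim (psnd m) x (claim_val t) \<in> S \<and> claim (pfst m) (claim_val t) y \<in> S)) \<or>
     (\<exists>m<c. c = 7 + 4 * m \<and> psnd x = 0 \<and> claim (pfst m) (pfst x) y \<in> S) \<or>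
     (\<exists>m<c. c = 7 + 4 * m \<and> (\<exists>k<psnd x. psnd x = Suc k \<and>
        (\<exists>t\<in>S. claim c (pair (pfst x) k) (claim_val t) \<in> S \<and>
           claim (psnd m) (pair (pfst x) (pair k (claim_val t))) y \<in> S))) \<or>
     (\<exists>m<c. c = 8 + 4 * m \<and> claim m (pair x y) 0 \<in> S \<and>
        (\<forall>k<y. \<exists>t\<in>S. claim_val t \<noteq> 0 \<and> claim m (pair x k) (claim_val t) \<in> S))"
  (is "_ \<longleftrightarrow> ?R")
proof
  \<comment> \<open>A claim in \<open>S\<close> is itself the witness \<open>t\<close> from which
    its value is read off.\<close>
  have val: "\<exists>t\<in>S. claim_val t = v \<and> claim c x v \<in> S" if "claim c x v \<in> S" for c x v
    using that by (auto intro!: bexI[of _ "claim c x v"] simp: claim_def)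
  assume "justified Q S c x y"
  then show ?R
  proof cases
    case (comp b u a)
    then show ?thesis using val[of b x u] by auto
  next
    case (prec_Suc a b z k v)
    then show ?thesis using val[of "7 + 4 * pair a b" "pair z k" v] by auto
  next
    case (mu a)
    have "\<exists>t\<in>S. claim_val t \<noteq> 0 \<and> claim a (pair x k) (claim_val t) \<in> S" if k: "k < y" for k
    proof -
      obtain v where "claim a (pair x k) (Suc v) \<in> S" using mu(3)[OF k] ..
      then show ?thesis by (intro bexI[of _ "claim a (pair x k) (Suc v)"]) (simp_all add: claim_def)
    qed
    then show ?thesis using mu(1,2) by auto
  qed auto
next
  assume ?R
  then show "justified Q S c x y"
  proof (elim disjE exE conjE bexE)
    fix m assume "c = 5 + 4 * m" "claim (pfst m) x (pfst y) \<in> S" "claim (psnd m) x (psnd y) \<in> S"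
    then show ?thesis using justified.tuple[of "pfst m" x "pfst y" S "psnd m" "psnd y" Q] by simp
  next
    fix m t assume "c = 6 + 4 * m"
      "claim (psnd m) x (claim_val t) \<in> S" "claim (pfst m) (claim_val t) y \<in> S"
    then show ?thesis using justified.comp[of "psnd m" x "claim_val t" S "pfst m" y Q] by simp
  next
    fix m assume "c = 7 + 4 * m" "psnd x = 0" "claim (pfst m) (pfst x) y \<in> S"
    then show ?thesis
      using justified.prec_0[of "pfst m" "pfst x" y S Q "psnd m"] pair_pfst_psnd[of x] by simp
  next
    fix m k t assume "c = 7 + 4 * m" "psnd x = Suc k"
      "claim c (pair (pfst x) k) (claim_val t) \<in> S"
      "claim (psnd m) (pair (pfst x) (pair k (claim_val t))) y \<in> S"
    then show ?thesis
      using justified.prec_Suc[of "pfst m" "psnd m" "pfst x" k "claim_val t" S y Q]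
        pair_pfst_psnd[of x] by simp
  next
    fix m assume m: "c = 8 + 4 * m" "claim m (pair x y) 0 \<in> S"
      "\<forall>k<y. \<exists>t\<in>S. claim_val t \<noteq> 0 \<and> claim m (pair x k) (claim_val t) \<in> S"
    then have "\<exists>v. claim m (pair x k) (Suc v) \<in> S" if "k < y" for k
      using that by (metis not0_implies_Suc)
    then show ?thesis using m(1,2) by (auto intro: justified.mu)
  qed (auto intro: justified.intros[unfolded One_nat_def])
qed

lemma decidable_justified:
  assumes C: "computable C" and X: "computable X" and Y: "computable Y" and Z: "computable Z"
    and N: "computable N" and Q: "decidable (\<lambda>p s. Q p s (X p s) (Y p s))"
  shows "decidable (\<lambda>p s. justified (Q p s) (entries (Z p s) (N p s)) (C p s) (X p s) (Y p s))"
  unfolding justified_iff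
  by (intro computable_intros C X Y Z N Q
      C[THEN computable_compose] X[THEN computable_compose] Y[THEN computable_compose]
      Z[THEN computable_compose] N[THEN computable_compose])

text \<open>\<open>Q\<close> is queried at entries of the derivation under a quantifier over
  positions, so its decidability is required for arbitrary computable terms.\<close>

lemma decidable_derivation:
  assumes Z: "computable Z" and N: "computable N"
    and Q: "\<And>S X Y. computable S \<Longrightarrow> computable X \<Longrightarrow> computable Y \<Longrightarrow>
      decidable (\<lambda>p s. Q p (S p s) (X p s) (Y p s))"
  shows "decidable (\<lambda>p s. derivation (Q p s) (map (ent (Z p s)) [0..<N p s]))"
proof -
  have "decidable (\<lambda>p s. \<forall>k<N p s. justified (Q p s) (entries (Z p s) k)
    (claim_prog (ent (Z p s) k)) (claim_arg (ent (Z p s) k)) (claim_val (ent (Z p s) k)))"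
    by (intro computable_intros decidable_justified N Z Q Z[THEN computable_compose])
  moreover have "derivation R (map (ent z) [0..<n]) \<longleftrightarrow> (\<forall>k<n. justified R (entries z k)
      (claim_prog (ent z k)) (claim_arg (ent z k)) (claim_val (ent z k)))" for R z n
    by (simp add: derivation_def entries_def take_map atLeast_upt)
  ultimately show ?thesis by (simp only:)
qed

section \<open>Search for approximations to solutions\<close>

text \<open>
  A number \<open>n\<close> codes the length \<open>pfst n\<close> and the entries \<open>pfst (psnd n)\<close> of a finite string,
  together with further data \<open>psnd (psnd n)\<close>.
\<close>

definition approximates :: "nat \<Rightarrow> (nat \<Rightarrow> nat) \<Rightarrow> bool" where
  "approximates n g \<longleftrightarrow> (\<forall>k<pfst n. ent (pfst (psnd n)) k = g k)"

abbreviation fop_instance :: "(nat \<Rightarrow> nat) \<Rightarrow> nat \<Rightarrow> nat \<Rightarrow> nat \<Rightarrow> nat" where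
  "fop_instance f e i \<equiv> join f (join (embed e) (embed i))"

text \<open>An instance \<open>p\<close> and the oracle \<open>join f g\<close> share their even
  half \<open>f\<close>, so \<open>p\<close> itself answers even queries; odd queries go to the
  string. Writing \<open>k + k\<close> under bounded quantifiers makes decidability
  immediate.\<close>

definition answers :: "(nat \<Rightarrow> nat) \<Rightarrow> nat \<Rightarrow> nat \<Rightarrow> nat \<Rightarrow> bool" where
  "answers p n x y \<longleftrightarrow>
     (\<exists>k<Suc x. x = k + k \<and> y = p x) \<or>
     (\<exists>k<pfst n. x = Suc (k + k) \<and> y = ent (pfst (psnd n)) k)"

lemma join_even [simp]: "join f g (k + k) = f k"
  and join_odd [simp]: "join f g (Suc (k + k)) = g k"
  by (simp_all add: join_def flip: mult_2)

lemma fop_instance_1: "fop_instance f e i 1 = e"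
  and fop_instance_3: "fop_instance f e i 3 = i"
  by (simp_all add: join_def embed_def)

lemma answers_sound:
  "approximates n g \<Longrightarrow> answers (join f r) n x y \<Longrightarrow> y = join f g x"
  by (auto simp: answers_def approximates_def)

text \<open>A query at \<open>Suc (k + k)\<close> reads entry \<open>k\<close> of the string, and
  \<open>k\<close> is smaller than the query, so a string longer than the query suffices.\<close>

lemma answers_complete:
  assumes "approximates n g" "x < pfst n"
  shows "answers (join f r) n x (join f g x)"
proof (cases "even x")
  case True
  then obtain k where "x = k + k" by (auto simp: mult_2 elim!: evenE)
  then show ?thesis by (intro answers_def[THEN iffD2] disjI1 exI[of _ k]) simp
next
  case False
  then obtain k where "x = Suc (k + k)" by (auto simp: mult_2 elim!: oddE)
  then show ?thesis using assms by (auto simp: answers_def approximates_def)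
qed

lemma decidable_answers:
  assumes "computable N" "computable X" "computable Y"
  shows "decidable (\<lambda>p s. answers p (N p s) (X p s) (Y p s))"
  unfolding answers_def
  by (intro computable_intros assms assms[THEN computable_compose])

text \<open>\<open>approx\<close> makes the search terminate and \<open>extend\<close> makes its
  result correct. \<open>ok\<close> is decidable for all oracles, but has to be meaningful only at
  genuine instances.\<close>

lemma uniformly_computably_true_first_order_part:
  assumes ok: "decidable ok"
    and extend: "\<And>f e i h n. maps_to e f h \<Longrightarrow> h \<in> instances P \<Longrightarrow> ok (fop_instance f e i) n \<Longrightarrow>
      \<exists>g\<in>P h. approximates n g"
    and approx: "\<And>f e i h g N. maps_to e f h \<Longrightarrow> g \<in> P h \<Longrightarrow>
      \<exists>n. ok (fop_instance f e i) n \<and> N \<le> pfst n \<and> approximates n g"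
  shows "uniformly_computably_true (first_order_part P)"
proof -
  \<comment> \<open>The number \<open>s\<close> packs a value, an approximation, and the length and
    code of a derivation; the index \<open>i\<close> of the second functional is read off as
    \<open>p 3\<close>.\<close>
  define found where "found p s \<longleftrightarrow> ok p (pfst (psnd s)) \<and>
      derivation (answers p (pfst (psnd s)))
        (map (ent (psnd (psnd (psnd s)))) [0..<pfst (psnd (psnd s))]) \<and>
      claim (p 3) 0 (pfst s) \<in> entries (psnd (psnd (psnd s))) (pfst (psnd (psnd s)))" for p s
  have "decidable (\<lambda>p s. ok p (pfst (psnd s)))"
    using computable_compose[OF ok[unfolded decidable_def], of "\<lambda>p s. pfst (psnd s)"]
    unfolding decidable_def by (simp add: computable_intros)
  then have "decidable found"
    unfolding found_def by (intro computable_intros decidable_derivation decidable_answers)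
  then obtain c where c: "\<And>p x. \<exists>s. found p s \<Longrightarrow> eval p c x = Some (LEAST s. found p s)"
    using decidable_Least by blast
  \<comment> \<open>By truncated subtraction the factor is 1 at argument 0 and 0 elsewhere, so the
    output is the embedded value.\<close>
  have "computable (\<lambda>p z. (1 - psnd z) * pfst (pfst z))"
    by (intro computable_intros)
  then obtain d where d: "\<And>p z. eval p d z = Some ((1 - psnd z) * pfst (pfst z))"
    unfolding computable_def by blast
  let ?c = "Comp d (Tuple c (Tuple Fst Snd))"
  have "\<exists>g. maps_to (encode ?c) p g \<and> g \<in> first_order_part P p"
    if p: "p \<in> instances (first_order_part P)" for p
  proof -
    obtain y f e i h where p: "p = fop_instance f e i"
      and h: "maps_to e f h" "h \<in> instances P"
      and conv: "\<forall>g \<in> P h. turing i (join f g) 0 \<noteq> None"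
      and y: "\<exists>g \<in> P h. turing i (join f g) 0 = Some y"
      using p unfolding instances_def[of "first_order_part P"] first_order_part_def by blast
    have p3: "p 3 = i" unfolding p by (rule fop_instance_3)
    have "\<exists>s. found p s"
    proof -
      obtain g where g: "g \<in> P h" "turing i (join f g) 0 = Some y" using y by blast
      obtain ts where ts: "derivation (\<lambda>u v. v = join f g u) ts" "claim i 0 y \<in> set ts"
        using derivable_turing[OF g(2)] by (auto simp: derivable_def)
      \<comment> \<open>\<open>N\<close> bounds all arguments in the derivation, in particular all
        oracle queries.\<close>
      obtain N where N: "\<And>t. t \<in> set ts \<Longrightarrow> claim_arg t < N"
        using finite_nat_set_iff_bounded[of "(\<lambda>t. claim_arg t) ` set ts"] by auto
      obtain n where n: "ok p n" "N \<le> pfst n" "approximates n g"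
        using approx[OF h(1) g(1)] p by blast
      have "derivation (answers p n) ts"
      proof (rule derivation_mono[OF ts(1)])
        fix u v assume "claim 4 u v \<in> set ts" "v = join f g u"
        then show "answers p n u v"
          using N[of "claim 4 u v"] n(2,3) by (auto simp: p claim_def intro!: answers_complete)
      qed
      moreover obtain z where z: "map (ent z) [0..<length ts] = ts" by (rule ex_ent_list)
      moreover have "entries z (length ts) = set ts"
        by (simp only: entries_eq z)
      ultimately have "found p (pair y (pair n (pair (length ts) z)))"
        using n(1) ts(2) by (simp add: found_def p3)
      then show ?thesis ..
    qed
    then have least: "found p (LEAST s. found p s)" and eval: "\<And>x. eval p c x = Some (LEAST s. found p s)"
      using c by (auto intro: LeastI_ex)
    define s where "s = (LEAST s. found p s)"
    have "maps_to (encode ?c) p (embed (pfst s))"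
      unfolding maps_to_def turing_def decode_encode
      by (simp add: eval d embed_def flip: s_def pair_def)
    moreover have "embed (pfst s) \<in> first_order_part P p"
    proof -
      let ?n = "pfst (psnd s)"
      let ?ts = "map (ent (psnd (psnd (psnd s)))) [0..<pfst (psnd (psnd s))]"
      have "found p s" using least by (simp add: s_def)
      then have found: "ok p ?n" "derivation (answers p ?n) ?ts" "claim i 0 (pfst s) \<in> set ?ts"
        by (simp_all add: found_def p3 entries_eq)
      \<comment> \<open>The least \<open>s\<close> need not come from the solution used for
        termination; the solution witnessing its value is obtained afresh by extending its
        approximation.\<close>
      obtain g where g: "g \<in> P h" "approximates ?n g"
        using extend[OF h] found(1) unfolding p by blast
      have "turing i (join f g) 0 = Some (pfst s)"
        unfolding turing_def using found(2) _ found(3)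
        by (rule derivation_sound) (use answers_sound[OF g(2)] in \<open>auto simp: p\<close>)
      then show ?thesis
        unfolding first_order_part_def using p h conv g(1) by blast
    qed
    ultimately show ?thesis by blast
  qed
  then show ?thesis unfolding uniformly_computably_true_def by blast
qed

section \<open>Binary strings as approximations: \<open>COH\<close> and \<open>Pi01G\<close>\<close>

definition binary :: "(nat \<Rightarrow> nat) \<Rightarrow> nat \<Rightarrow> bool" where
  "binary p n \<longleftrightarrow> (\<forall>k<pfst n. ent (pfst (psnd n)) k < 2)"

lemma decidable_binary: "decidable binary"
  unfolding binary_def by (intro computable_intros)

lemma ex_approximates:
  obtains n where "pfst n = N" "approximates n g" "psnd (psnd n) = r"
proof -
  obtain z where "\<forall>k<N. ent z k = g k" by (rule ex_ent)
  then show thesis using that[of "pair N (pair z r)"] by (simp add: approximates_def)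
qed

lemma ex_binary:
  obtains n where "binary p n" "N \<le> pfst n" "approximates n (char_fun X)"
proof -
  obtain n where "pfst n = N" "approximates n (char_fun X)" by (rule ex_approximates)
  then show thesis
    using that[of n] by (auto simp: binary_def approximates_def char_fun_def indicator_def)
qed

lemma approximates_char_fun:
  assumes "binary p n" "\<And>k. k < pfst n \<Longrightarrow> k \<in> X \<longleftrightarrow> ent (pfst (psnd n)) k = 1"
  shows "approximates n (char_fun X)"
  using assms by (fastforce simp: binary_def approximates_def char_fun_def indicator_def less_2_cases_iff)

text \<open>Infinitude and cohesiveness survive finite changes, so the beginning of any solution can
  be overwritten by the given string.\<close>

lemma COH_first_order_part: "uniformly_computably_true (first_order_part COH)"
proof (rule uniformly_computably_true_first_order_part[OF decidable_binary])
  fix f e i h n assume h: "h \<in> instances COH" and n: "binary (fop_instance f e i) n"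
  obtain X A where XA: "h = family_code A" "infinite X" "cohesive X A"
    using h by (auto simp: instances_def COH_def)
  define Y where "Y = {k. if k < pfst n then ent (pfst (psnd n)) k = 1 else k \<in> X}"
  have finite: "finite ((Y - X) \<union> (X - Y))"
    by (rule finite_subset[of _ "{..<pfst n}"]) (auto simp: Y_def)
  have "infinite Y"
  proof
    assume "finite Y"
    then have "finite (Y \<union> ((Y - X) \<union> (X - Y)))" using finite by blast
    then have "finite X" by (rule rev_finite_subset) blast
    with XA(2) show False ..
  qed
  moreover have "finite (Y \<inter> B)" if "finite (X \<inter> B)" for B
    by (rule finite_subset[OF _ finite_UnI[OF that finite]]) blast
  then have "cohesive Y A" using XA(3) unfolding cohesive_def by blast
  ultimately have "char_fun Y \<in> COH h" using XA(1) by (auto simp: COH_def)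
  moreover have "approximates n (char_fun Y)"
    by (rule approximates_char_fun[OF n]) (simp add: Y_def)
  ultimately show "\<exists>g\<in>COH h. approximates n g" by blast
next
  fix f e i h g N assume "g \<in> COH h"
  then obtain X where "g = char_fun X" by (auto simp: COH_def)
  then show "\<exists>n. binary (fop_instance f e i) n \<and> N \<le> pfst n \<and> approximates n g"
    using ex_binary[of "fop_instance f e i" N X] by blast
qed

text \<open>A Baire category argument: starting from \<sigma>, stage \<open>n\<close> extends the
  current string into \<open>U n\<close>, and \<open>G\<close> is the union of the strings.\<close>

lemma ex_generic:
  assumes "\<And>i::nat. dense_strings (U i)"
  obtains G where "restrict_set G (length \<sigma>) = \<sigma>" "\<forall>i. \<exists>k. restrict_set G k \<in> U i"
proof -
  obtain ext where ext: "\<And>i \<tau>. ext i \<tau> \<in> U i" "\<And>i \<tau>. prefix \<tau> (ext i \<tau>)"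
    using assms unfolding dense_strings_def by metis
  define s where "s = rec_nat \<sigma> ext"
  have s: "s 0 = \<sigma>" "\<And>n. s (Suc n) = ext n (s n)" by (simp_all add: s_def)
  have mono: "prefix (s m) (s n)" if "m \<le> n" for m n
    using that by (induction rule: dec_induct) (auto simp: s intro: prefix_order.trans ext(2))
  \<comment> \<open>The strings may stop growing; positions that none of them reaches stay outside
    \<open>G\<close>.\<close>
  define G where "G = {k. \<exists>n. k < length (s n) \<and> s n ! k}"
  have nth: "s m ! k = s n ! k" if "k < length (s m)" "k < length (s n)" for m n k
  proof -
    have "s m ! k = s n ! k" if "k < length (s m)" "m \<le> n" for m n
      using mono[OF that(2)] that(1) by (auto simp: prefix_def nth_append)
    then show ?thesis using that nat_le_linear[of m n] by metis
  qed
  have restrict: "restrict_set G (length (s n)) = s n" for n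
    by (rule nth_equalityI) (auto simp: restrict_set_def G_def dest: nth[of _ _ n])
  show thesis
  proof (rule that)
    show "restrict_set G (length \<sigma>) = \<sigma>" using restrict[of 0] by (simp add: s)
    show "\<forall>i. \<exists>k. restrict_set G k \<in> U i"
      using restrict[of "Suc _"] ext(1) unfolding s(2) by metis
  qed
qed

lemma Pi01G_first_order_part: "uniformly_computably_true (first_order_part Pi01G)"
proof (rule uniformly_computably_true_first_order_part[OF decidable_binary])
  fix f e i h n assume h: "h \<in> instances Pi01G" and n: "binary (fop_instance f e i) n"
  \<comment> \<open>\<open>f'\<close> and \<open>e'\<close> present the computed instance
    \<open>h\<close>, whereas \<open>f\<close> and \<open>e\<close> are the data from which
    \<open>h\<close> is computed.\<close>
  obtain f' e' where e': "h = join f' (embed e')" "\<And>i. dense_strings (Pi01_family e' f' i)"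
    using h by (auto simp: instances_def Pi01G_def)
  define \<sigma> where "\<sigma> = map (\<lambda>k. ent (pfst (psnd n)) k = 1) [0..<pfst n]"
  obtain G where G: "restrict_set G (length \<sigma>) = \<sigma>"
    "\<forall>i. \<exists>k. restrict_set G k \<in> Pi01_family e' f' i"
    by (rule ex_generic[OF e'(2), of \<sigma>])
  have "char_fun G \<in> Pi01G h" using e' G(2) by (auto simp: Pi01G_def)
  moreover have "approximates n (char_fun G)"
    using G(1) by (intro approximates_char_fun[OF n]) (auto simp: \<sigma>_def restrict_set_def)
  ultimately show "\<exists>g\<in>Pi01G h. approximates n g" by blast
next
  fix f e i h g N assume "g \<in> Pi01G h"
  then obtain X where "g = char_fun X" by (auto simp: Pi01G_def)
  then show "\<exists>n. binary (fop_instance f e i) n \<and> N \<le> pfst n \<and> approximates n g"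
    using ex_binary[of "fop_instance f e i" N X] by blast
qed

section \<open>Maximal subfamilies\<close>

lemma family_code_eq: "family_code A k = of_bool (psnd k \<in> A (pfst k))"
proof -
  have "k = prod_encode (i, x) \<longleftrightarrow> i = pfst k \<and> x = psnd k" for i x
    by (metis pair_def pair_pfst_psnd pfst_pair psnd_pair)
  then show ?thesis by (auto simp: family_code_def char_fun_def indicator_def)
qed

text \<open>Passing to ranges removes order and repetitions, so that Zorn's lemma applies to sets of
  sets. The empty \<open>F\<close> is harmless because its intersection is
  \<open>UNIV\<close>.\<close>

lemma finite_intersection_property_iff:
  "finite_intersection_property A \<longleftrightarrow> (\<forall>F\<subseteq>range A. finite F \<longrightarrow> \<Inter>F \<noteq> {})"
proof
  assume fip: "finite_intersection_property A"
  show "\<forall>F\<subseteq>range A. finite F \<longrightarrow> \<Inter>F \<noteq> {}"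
  proof (intro allI impI)
    fix F assume "F \<subseteq> range A" "finite F"
    then obtain J where J: "finite J" "F = A ` J" by (metis finite_subset_image)
    show "\<Inter>F \<noteq> {}"
      using fip J by (cases "J = {}") (auto simp: finite_intersection_property_def)
  qed
next
  assume "\<forall>F\<subseteq>range A. finite F \<longrightarrow> \<Inter>F \<noteq> {}"
  then show "finite_intersection_property A"
    unfolding finite_intersection_property_def by (metis finite_imageI image_mono subset_UNIV)
qed

lemma ex_maximal_fip_subfamily:
  assumes S: "S \<subseteq> range A" "finite S" "\<Inter>S \<noteq> {}" and nonempty: "A i \<noteq> {}"
  obtains M where "S \<subseteq> M" "M \<noteq> {}" "M \<subseteq> range A"
    "\<forall>B. range B = M \<longrightarrow> maximal_fip_subfamily B A"
proof -
  define fip where "fip M \<longleftrightarrow> (\<forall>F\<subseteq>M. finite F \<longrightarrow> \<Inter>F \<noteq> {})" for M :: "nat set set"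
  \<comment> \<open>Starting from \<open>{A i}\<close> when \<open>S\<close> is empty ensures that
    \<open>M\<close> is nonempty and can be enumerated as a family.\<close>
  define S' where "S' = (if S = {} then {A i} else S)"
  let ?P = "{M. S' \<subseteq> M \<and> M \<subseteq> range A \<and> fip M}"
  have "\<Inter>F \<noteq> {}" if "F \<subseteq> S'" for F
    using that S(3) nonempty Inter_anti_mono[of F S'] by (auto simp: S'_def split: if_splits)
  then have S': "S' \<in> ?P" using S(1) by (auto simp: fip_def S'_def)
  have "\<exists>M\<in>?P. \<forall>X\<in>?P. M \<subseteq> X \<longrightarrow> X = M"
  proof (rule subset_Zorn_nonempty)
    show "\<Union>\<C> \<in> ?P" if chain: "\<C> \<noteq> {}" "subset.chain ?P \<C>" for \<C>
    proof -
      have sub: "\<C> \<subseteq> ?P" using chain(2) by (simp add: subset.chain_def)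
      have "fip (\<Union>\<C>)"
        unfolding fip_def
      proof (intro allI impI)
        fix F assume "F \<subseteq> \<Union>\<C>" "finite F"
        \<comment> \<open>A finite subset of the union of a chain already lies in one of its
          members.\<close>
        then obtain X where "X \<in> \<C>" "F \<subseteq> X"
          using finite_subset_Union_chain[OF _ _ chain] by blast
        then show "\<Inter>F \<noteq> {}" using sub \<open>finite F\<close> by (auto simp: fip_def)
      qed
      then show ?thesis using sub chain(1) by blast
    qed
  qed (use S' in blast)
  then obtain M where M: "S' \<subseteq> M" "M \<subseteq> range A" "fip M"
    and max: "\<And>X. S' \<subseteq> X \<Longrightarrow> X \<subseteq> range A \<Longrightarrow> fip X \<Longrightarrow> M \<subseteq> X \<Longrightarrow> X = M"
    by auto
  show thesis
  proof (rule that)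
    show "S \<subseteq> M" "M \<noteq> {}" using M(1) by (auto simp: S'_def split: if_splits)
    have "maximal_fip_subfamily B A" if "range B = M" for B
      unfolding maximal_fip_subfamily_def
    proof (intro conjI allI impI; (elim conjE)?)
      have subfamily_iff: "subfamily C D \<longleftrightarrow> range C \<subseteq> range D" for C D
        unfolding subfamily_def by blast
      show "subfamily B A" using M(2) that by (simp add: subfamily_iff)
      show "finite_intersection_property B"
        using M(3) that by (simp add: finite_intersection_property_iff fip_def)
      fix C assume "subfamily C A" "finite_intersection_property C" "subfamily B C"
      then show "subfamily C B"
        using max[of "range C"] M(1) that
        by (auto simp: subfamily_iff finite_intersection_property_iff fip_def)
    qed
    then show "\<forall>B. range B = M \<longrightarrow> maximal_fip_subfamily B A" by blast
  qed (rule M(2))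
qed

text \<open>The common element \<open>w\<close> lets Zorn's lemma start from the prescribed members.
  As maximality depends only on the range, \<open>B\<close> may list these first and then enumerate
  all of \<open>M\<close>.\<close>

lemma ex_maximal_fip_subfamily_extending:
  assumes w: "\<And>k. k < n \<Longrightarrow> w \<in> A (j k)" and nonempty: "A i \<noteq> {}"
  obtains B where "maximal_fip_subfamily B A" "\<forall>k<n. B k = A (j k)"
proof -
  let ?S = "(\<lambda>k. A (j k)) ` {..<n}"
  have S: "?S \<subseteq> range A" "finite ?S" by auto
  have "\<Inter>?S \<noteq> {}" using w by blast
  from S this nonempty obtain M where M: "?S \<subseteq> M" "M \<noteq> {}" "M \<subseteq> range A"
    and max: "\<forall>B. range B = M \<longrightarrow> maximal_fip_subfamily B A"
    by (rule ex_maximal_fip_subfamily)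
  have "countable M" using M(3) by (rule countable_subset) simp
  then obtain E :: "nat \<Rightarrow> nat set" where E: "range E = M"
    using M(2) by (metis range_from_nat_into)
  define B where "B k = (if k < n then A (j k) else E (k - n))" for k
  have "range B = M"
  proof
    show "range B \<subseteq> M" using M(1) E by (auto simp: B_def)
    have "E k = B (k + n)" for k by (simp add: B_def)
    then show "M \<subseteq> range B" using E by auto
  qed
  then have "maximal_fip_subfamily B A" using max by blast
  then show thesis by (rule that) (simp add: B_def)
qed

text \<open>
  The further data of \<open>n\<close> consist of indices \<open>j k\<close> of members of the family, a common element of
  these members, and a derivation of the values of \<open>\<Phi>(f)\<close> which show that the string agrees with
  the family of the \<open>A (j k)\<close>.
\<close>

definition fip_approximation :: "(nat \<Rightarrow> nat) \<Rightarrow> nat \<Rightarrow> bool" where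
  "fip_approximation p n \<longleftrightarrow>
     (let N = pfst n; \<sigma> = ent (pfst (psnd n)); r = psnd (psnd n);
        j = ent (pfst r); w = pfst (psnd r); K = pfst (psnd (psnd r)); z = psnd (psnd (psnd r))
      in derivation (\<lambda>x y. y = p (x + x)) (map (ent z) [0..<K]) \<and>
         (\<forall>k<N. claim (p 1) (pair (j (pfst k)) (psnd k)) (\<sigma> k) \<in> entries z K) \<and>
         (\<forall>k<N. claim (p 1) (pair (j k) w) 1 \<in> entries z K))"

lemma decidable_fip_approximation: "decidable fip_approximation"
  unfolding fip_approximation_def Let_def by (intro computable_intros decidable_derivation)

text \<open>The family is known only through the functional with index \<open>e\<close>, which may
  diverge at oracles outside the domain; carrying a derivation of the needed values keeps the test
  total.\<close>

lemma FIP_first_order_part: "uniformly_computably_true (first_order_part FIP)"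
proof (rule uniformly_computably_true_first_order_part[OF decidable_fip_approximation])
  fix f e i h n
  assume e: "maps_to e f h" and h: "h \<in> instances FIP"
    and n: "fip_approximation (fop_instance f e i) n"
  obtain A m where A: "h = family_code A" "A m \<noteq> {}"
    using h by (auto simp: instances_def FIP_def)
  define r where "r = psnd (psnd n)"
  define j where "j = ent (pfst r)"
  define w where "w = pfst (psnd r)"
  define z where "z = psnd (psnd (psnd r))"
  define K where "K = pfst (psnd (psnd r))"
  \<comment> \<open>In the instance, \<open>p 1\<close> is \<open>e\<close> and
    \<open>p (x + x)\<close> is \<open>f x\<close>, so the derivation is about values of
    \<open>h\<close>.\<close>
  have n: "derivation (\<lambda>x y. y = f x) (map (ent z) [0..<K])"
    "\<And>k. k < pfst n \<Longrightarrow> claim e (pair (j (pfst k)) (psnd k)) (ent (pfst (psnd n)) k) \<in> entries z K"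
    "\<And>k. k < pfst n \<Longrightarrow> claim e (pair (j k) w) 1 \<in> entries z K"
    using n unfolding fip_approximation_def Let_def fop_instance_1 join_even
    by (simp_all flip: r_def) (simp_all add: j_def w_def z_def K_def)
  have val: "y = of_bool (x \<in> A l)" if "claim e (pair l x) y \<in> entries z K" for l x y
  proof -
    have "claim e (pair l x) y \<in> set (map (ent z) [0..<K])"
      using that by (simp add: entries_eq)
    then have "eval f (decode e) (pair l x) = Some y"
      using derivation_sound[OF n(1), of f e "pair l x" y] by simp
    then show ?thesis using e by (simp add: maps_to_def turing_def A(1) family_code_eq)
  qed
  have "w \<in> A (j k)" if "k < pfst n" for k
    using val[OF n(3)[OF that]] by (cases "w \<in> A (j k)") simp_all
  from this A(2) obtain B where B: "maximal_fip_subfamily B A" "\<forall>k<pfst n. B k = A (j k)"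
    by (rule ex_maximal_fip_subfamily_extending)
  have "approximates n (family_code B)"
    unfolding approximates_def
  proof (intro allI impI)
    fix k assume k: "k < pfst n"
    \<comment> \<open>Position \<open>k\<close> of the string concerns the member with index
      \<open>pfst k\<close>, which is at most \<open>k\<close> and so among the prescribed
      ones.\<close>
    then have "B (pfst k) = A (j (pfst k))" using B(2) le_less_trans[OF pfst_le] by blast
    then show "ent (pfst (psnd n)) k = family_code B k"
      using val[OF n(2)[OF k]] by (simp add: family_code_eq)
  qed
  moreover have "family_code B \<in> FIP h" using A B(1) by (auto simp: FIP_def)
  ultimately show "\<exists>g\<in>FIP h. approximates n g" by blast
next
  fix f e i h g N
  assume e: "maps_to e f h" and "g \<in> FIP h"
  then obtain A B where AB: "h = family_code A" "g = family_code B" "maximal_fip_subfamily B A"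
    by (auto simp: FIP_def)
  then have "\<forall>k. \<exists>l. B k = A l" by (simp add: maximal_fip_subfamily_def subfamily_def)
  then obtain j where j: "\<And>k. B k = A (j k)" by metis
  have "\<Inter>(B ` {..<N}) \<noteq> {}"
    using AB(3) by (simp add: maximal_fip_subfamily_def finite_intersection_property_iff image_mono)
  then obtain w where "w \<in> \<Inter>(B ` {..<N})" by blast
  then have w: "w \<in> B k" if "k < N" for k using that by blast
  \<comment> \<open>The finitely many values of \<open>h\<close> to be certified: those giving the
    first \<open>N\<close> bits of \<open>g\<close>, and those placing \<open>w\<close> in the first
    \<open>N\<close> members of \<open>B\<close>.\<close>
  let ?S = "(\<lambda>k. claim e (pair (j (pfst k)) (psnd k)) (g k)) ` {..<N} \<union>
    (\<lambda>k. claim e (pair (j k) w) 1) ` {..<N}"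
  have "derivable (\<lambda>x y. y = f x) (claim e x (h x))" for x
    using e by (auto simp: maps_to_def intro: derivable_turing)
  moreover have "g k = h (pair (j (pfst k)) (psnd k))" for k
    by (simp add: AB family_code_eq j)
  moreover have "1 = h (pair (j k) w)" if "k < N" for k
    using w[OF that] by (simp add: AB family_code_eq j)
  ultimately have "\<forall>t\<in>?S. derivable (\<lambda>x y. y = f x) t"
    by auto
  then obtain ts where ts: "derivation (\<lambda>x y. y = f x) ts" "?S \<subseteq> set ts"
    by (rule ex_derivation[rotated]) simp_all
  obtain z where z: "map (ent z) [0..<length ts] = ts" by (rule ex_ent_list)
  then have entries: "entries z (length ts) = set ts"
    by (simp only: entries_eq)
  obtain jz where jz: "\<forall>k<N. ent jz k = j k" by (rule ex_ent)
  obtain n where n: "pfst n = N" "approximates n g"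
    "psnd (psnd n) = pair jz (pair w (pair (length ts) z))"
    by (rule ex_approximates)
  have "claim e (pair (ent jz (pfst k)) (psnd k)) (ent (pfst (psnd n)) k) \<in> set ts"
    "claim e (pair (ent jz k) w) 1 \<in> set ts" if k: "k < N" for k
  proof -
    have "ent jz (pfst k) = j (pfst k)" "ent jz k = j k" "ent (pfst (psnd n)) k = g k"
      using jz k n(1,2) le_less_trans[OF pfst_le k] by (simp_all add: approximates_def)
    then show "claim e (pair (ent jz (pfst k)) (psnd k)) (ent (pfst (psnd n)) k) \<in> set ts"
      "claim e (pair (ent jz k) w) 1 \<in> set ts"
      using ts(2) k by (simp_all only:) blast+
  qed
  then have "fip_approximation (fop_instance f e i) n"
    unfolding fip_approximation_def Let_def n(1,3) fop_instance_1 join_even pfst_pair psnd_pair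
    by (simp add: z entries ts(1))
  then show "\<exists>n. fip_approximation (fop_instance f e i) n \<and> N \<le> pfst n \<and> approximates n g"
    using n by blast
qed

theorem corollary3p7:
  shows "uniformly_computably_true (first_order_part COH)
    \<and> uniformly_computably_true (first_order_part FIP)
    \<and> uniformly_computably_true (first_order_part Pi01G)"
  using COH_first_order_part FIP_first_order_part Pi01G_first_order_part by blast

end
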